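(* Let $w\in\{a,b\}^{\mathbb{Z}}$ be a bi-infinite word obtained by the inductive construction described in the context, and let $p$ be its complexity function. Then $p(n)$ is not dominated by any polynomial function in $n$: there is no polynomial $P$ such that $p(n)\le P(n)$ for all sufficiently large $n$.
   Context: $p(n)$ is the number of distinct subwords (factors) of length $n$ of $w$; $|f|$ denotes the length of a finite word $f$. Construction of $w$. Choose a finite word $f_1$ over $\{a,b\}$ in which all words of length $2$ over $\{a,b\}$ appear as factors, except $aa$ (which does not appear). Put $u_1=aab\,f_1\,baa$ and $v_1=abb\,f_1\,baa$. Inductively, given $u_k,v_k$ of the same length, choose a finite word over $\{0,1\}$ not containing $00$ and in which every word of length $|u_k|$ over $\{0,1\}$ not containing $00$ appears as a factor; apply to it the substitution $0\mapsto u_k$, $1\mapsto v_k$, and call $f_{k+1}$ the resulting word over $\{a,b\}$. Put $$u_{k+1}=u_ku_kv_kf_{k+1}v_ku_ku_k,\qquad v_{k+1}=u_kv_kv_kf_{k+1}v_ku_ku_k .$$ For every $k$, $u_k$ appears in $f_{k+1}$, hence in the middle of $u_{k+1}$. For each $k$ choose an occurrence of $u_k$ in the factor $f_{k+1}$ of $u_{k+1}$; this makes $(u_k)_{k\ge1}$ a sequence of finite words increasing on both ends, and $w$ is the bi-infinite word which is its limit (increasing union). *)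

theory Defs
  imports "HOL-Library.Sublist" "HOL-Computational_Algebra.Polynomial"
begin

datatype letter = A | B

datatype digit = Zero | One

definition seed_word :: "letter list \<Rightarrow> bool" where
  "seed_word f \<longleftrightarrow> (\<forall>z. length z = 2 \<longrightarrow> (sublist z f \<longleftrightarrow> z \<noteq> [A, A]))"

definition avoids_00 :: "digit list \<Rightarrow> bool" where
  "avoids_00 z \<longleftrightarrow> \<not> sublist [Zero, Zero] z"

definition universal_word :: "nat \<Rightarrow> digit list \<Rightarrow> bool" where
  "universal_word n g \<longleftrightarrow>
     avoids_00 g \<and> (\<forall>z. length z = n \<longrightarrow> avoids_00 z \<longrightarrow> sublist z g)"

definition substitution :: "letter list \<Rightarrow> letter list \<Rightarrow> digit list \<Rightarrow> letter list" where
  "substitution u v g = concat (map (\<lambda>d. case d of Zero \<Rightarrow> u | One \<Rightarrow> v) g)"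

text \<open>The sequences are indexed from 1; their values at index 0 are irrelevant.
  The equality of the lengths of \<open>u k\<close> and \<open>v k\<close> is a consequence of the
  recursion and is not imposed separately.\<close>

definition construction ::
  "(nat \<Rightarrow> letter list) \<Rightarrow> (nat \<Rightarrow> letter list) \<Rightarrow> (nat \<Rightarrow> letter list) \<Rightarrow> bool" where
  "construction u v f \<longleftrightarrow>
     seed_word (f 1) \<and>
     u 1 = [A, A, B] @ f 1 @ [B, A, A] \<and>
     v 1 = [A, B, B] @ f 1 @ [B, A, A] \<and>
     (\<forall>k\<ge>1.
        (\<exists>g. universal_word (length (u k)) g \<and> f (Suc k) = substitution (u k) (v k) g) \<and>
        u (Suc k) = u k @ u k @ v k @ f (Suc k) @ v k @ u k @ u k \<and>
        v (Suc k) = u k @ v k @ v k @ f (Suc k) @ v k @ u k @ u k)"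

definition occurs_at :: "letter list \<Rightarrow> (int \<Rightarrow> letter) \<Rightarrow> int \<Rightarrow> bool" where
  "occurs_at z w i \<longleftrightarrow> (\<forall>j<length z. w (i + int j) = z ! j)"

text \<open>\<open>pos k\<close> is the position in \<open>w\<close> at which the copy of \<open>u k\<close> in the increasing union
  starts. The chosen occurrence of \<open>u k\<close> in \<open>f (Suc k)\<close>, not necessarily aligned with the
  blocks of the substitution, is given by \<open>f (Suc k) = x @ u k @ y\<close>; since
  \<open>u (Suc k)\<close> starts with \<open>u k @ u k @ v k @ f (Suc k)\<close>, this determines \<open>pos (Suc k)\<close>
  from \<open>pos k\<close>. The origin, i.e. \<open>pos 1\<close>, is arbitrary. As the copies grow strictly on both
  ends, they cover all of the integers, so \<open>w\<close> is determined by the positions.\<close>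

definition limit_word ::
  "(nat \<Rightarrow> letter list) \<Rightarrow> (nat \<Rightarrow> letter list) \<Rightarrow> (nat \<Rightarrow> letter list) \<Rightarrow> (int \<Rightarrow> letter) \<Rightarrow> bool" where
  "limit_word u v f w \<longleftrightarrow>
     (\<exists>pos :: nat \<Rightarrow> int. \<forall>k\<ge>1.
        occurs_at (u k) w (pos k) \<and>
        (\<exists>x y. f (Suc k) = x @ u k @ y \<and>
               pos (Suc k) = pos k - int (length (u k @ u k @ v k @ x))))"

definition complexity :: "(int \<Rightarrow> letter) \<Rightarrow> nat \<Rightarrow> nat" where
  "complexity w n = card {z. length z = n \<and> (\<exists>i. occurs_at z w i)}"

end

(* For L = |u_k|, the factor f_(k+1) of w contains the image under the substitution of every
   binary word of length L without 00. As u_k and v_k are distinct of equal length, these images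
   are pairwise distinct factors of w of length L^2, and there are at least 2^(L div 2) of
   them. So p(L^2) grows faster than any polynomial in L. *)

theory Submission
  imports Defs "HOL-Real_Asymp.Real_Asymp"
begin

lemma avoids_00_Cons_One: "avoids_00 z \<Longrightarrow> avoids_00 (d # One # z)"
  by (auto simp: avoids_00_def sublist_Cons_right)

text \<open>Needed for every cardinality comparison below, since \<open>card\<close> of an infinite
  set is 0. The predicate \<open>Q\<close> is left free to cover both digit words and factors of
  \<open>w\<close>.\<close>

lemma finite_words:
  assumes "finite (UNIV :: 'a set)"
  shows "finite {z :: 'a list. length z = n \<and> Q z}"
  by (rule rev_finite_subset [OF finite_lists_length_eq [OF assms, of n]]) auto

lemma finite_UNIV_digit: "finite (UNIV :: digit set)"
  by (rule finite_subset [of _ "{Zero, One}"]) (auto intro: digit.exhaust)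

lemma finite_UNIV_letter: "finite (UNIV :: letter set)"
  by (rule finite_subset [of _ "{A, B}"]) (auto intro: letter.exhaust)

text \<open>Prefixing \<open>Zero, One\<close> or \<open>One, One\<close> keeps a word free of 00,
  because the \<open>One\<close> separates the new first digit from the rest. The two prefixes give
  disjoint injective images, so the count at least doubles whenever the length grows by 2.\<close>

lemma card_avoids_00: "2 ^ (n div 2) \<le> card {z. length z = n \<and> avoids_00 z}"
proof (induction n rule: induct_nat_012)
  case 0
  have "{z. length z = 0 \<and> avoids_00 z} = {[]}"
    by (auto simp: avoids_00_def)
  then show ?case by simp
next
  case 1
  have "[One] \<in> {z. length z = Suc 0 \<and> avoids_00 z}"
    by (auto simp: avoids_00_def sublist_Cons_right)
  then have "card {z. length z = Suc 0 \<and> avoids_00 z} > 0"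
    using finite_words[OF finite_UNIV_digit, of "Suc 0" avoids_00] unfolding card_gt_0_iff by blast
  then show ?case by simp
next
  case (ge2 n)
  let ?Z = "\<lambda>n. {z. length z = n \<and> avoids_00 z}"
  have "2 ^ (Suc (Suc n) div 2) \<le> 2 * card (?Z n)"
    using ge2 by simp
  also have "\<dots> = card ((\<lambda>z. Zero # One # z) ` ?Z n) + card ((\<lambda>z. One # One # z) ` ?Z n)"
    by (simp add: card_image inj_on_def)
  also have "\<dots> = card ((\<lambda>z. Zero # One # z) ` ?Z n \<union> (\<lambda>z. One # One # z) ` ?Z n)"
    by (rule card_Un_disjoint [symmetric]) (use finite_words[OF finite_UNIV_digit] in auto)
  also have "\<dots> \<le> card (?Z (Suc (Suc n)))"
    by (rule card_mono [OF finite_words[OF finite_UNIV_digit]]) (auto intro: avoids_00_Cons_One)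
  finally show ?case .
qed

lemma substitution_simps [simp]:
  "substitution u v [] = []"
  "substitution u v (d # z) = (case d of Zero \<Rightarrow> u | One \<Rightarrow> v) @ substitution u v z"
  "substitution u v (y @ z) = substitution u v y @ substitution u v z"
  by (simp_all add: substitution_def)

lemma length_substitution:
  "length v = length u \<Longrightarrow> length (substitution u v z) = length z * length u"
  by (induction z) (auto split: digit.split)

text \<open>Blocks of equal length make the cut points of the image known in advance, and distinct
  blocks then reveal each digit.\<close>

lemma substitution_inject:
  assumes "length u = length v" "u \<noteq> v"
  shows "length y = length z \<Longrightarrow> substitution u v y = substitution u v z \<Longrightarrow> y = z"
  by (induction y z rule: list_induct2) (use assms in \<open>auto split: digit.splits\<close>)

lemma sublist_substitution:
  "sublist y z \<Longrightarrow> sublist (substitution u v y) (substitution u v z)"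
  by (auto simp: sublist_def) blast

lemma occurs_at_sublist:
  assumes "occurs_at z w i" "sublist y z"
  shows "\<exists>j. occurs_at y w j"
proof -
  obtain p s where z: "z = p @ y @ s"
    using assms(2) by (auto simp: sublist_def)
  have "w (i + int (length p) + int j) = y ! j" if "j < length y" for j
    using assms(1)[unfolded occurs_at_def, rule_format, of "length p + j"] that
    by (simp add: z nth_append add.assoc)
  then show ?thesis
    unfolding occurs_at_def by blast
qed

text \<open>\<open>u (Suc k)\<close> and \<open>v (Suc k)\<close> agree except in their second
  block, which is \<open>u k\<close> in one and \<open>v k\<close> in the other; so equal length and
  distinctness pass from \<open>k\<close> to \<open>Suc k\<close>. At the start the second letters
  differ. The lengths grow strictly, hence the bound by \<open>k\<close>.\<close>

lemma construction_lengths: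
  assumes "construction u v f" "k \<ge> 1"
  shows "length (v k) = length (u k) \<and> u k \<noteq> v k \<and> k \<le> length (u k)"
  using assms(2)
proof (induction k rule: dec_induct)
  case base
  then show ?case
    using assms(1) by (simp add: construction_def)
next
  case (step k)
  then show ?case
    using assms(1) by (auto simp: construction_def)
qed

lemma complexity_lower_bound:
  assumes c: "construction u v f" and l: "limit_word u v f w" and k: "k \<ge> 1"
  shows "2 ^ (length (u k) div 2) \<le> complexity w (length (u k) ^ 2)"
proof -
  let ?L = "length (u k)"
  let ?Z = "{z. length z = ?L \<and> avoids_00 z}"
  let ?s = "substitution (u k) (v k)"
  note lens = construction_lengths[OF c k]
  obtain g where g: "universal_word ?L g" "f (Suc k) = ?s g"
    using c k unfolding construction_def by blast
  have "u (Suc k) = (u k @ u k @ v k) @ f (Suc k) @ v k @ u k @ u k"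
    using c k by (simp add: construction_def)
  then have "sublist (f (Suc k)) (u (Suc k))"
    unfolding sublist_def by blast
  moreover obtain i where "occurs_at (u (Suc k)) w i"
    using l unfolding limit_word_def by (metis le_add2 plus_1_eq_Suc le_SucI k)
  ultimately obtain i where f: "occurs_at (f (Suc k)) w i"
    using occurs_at_sublist by blast
  have "\<exists>j. occurs_at (?s z) w j" if "z \<in> ?Z" for z
  proof -
    have "sublist z g"
      using g(1) that by (auto simp: universal_word_def)
    then have "sublist (?s z) (f (Suc k))"
      unfolding g(2) by (rule sublist_substitution)
    with f show ?thesis
      by (rule occurs_at_sublist)
  qed
  \<comment> \<open>Each image consists of \<open>?L\<close> blocks of length \<open>?L\<close>,
    which is where the square comes from.\<close>
  then have sub: "?s ` ?Z \<subseteq> {z. length z = ?L ^ 2 \<and> (\<exists>i. occurs_at z w i)}"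
    using lens by (auto simp: length_substitution power2_eq_square)
  have "inj_on ?s ?Z"
    using lens by (intro inj_onI) (auto intro: substitution_inject[of "u k" "v k"])
  then have "card ?Z = card (?s ` ?Z)"
    by (simp add: card_image)
  also have "\<dots> \<le> complexity w (?L ^ 2)"
    unfolding complexity_def by (rule card_mono [OF finite_words[OF finite_UNIV_letter] sub])
  finally show ?thesis
    using card_avoids_00[of ?L] by linarith
qed

text \<open>The argument is squared to match factors of length \<open>n ^ 2\<close> counted by words
  of length \<open>n\<close>. Each monomial is negligible against the exponential, and
  \<open>P\<close> has finitely many.\<close>

lemma eventually_poly_square_less_exp:
  fixes P :: "real poly"
  shows "\<forall>\<^sub>F n in sequentially. poly P (real (n ^ 2)) < 2 ^ (n div 2)"
proof -
  \<comment> \<open>The exponent \<open>x / 2 - 1\<close> is a lower bound for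
    \<open>n div 2\<close> without rounding, so the limit can be taken over the reals.\<close>
  have "((\<lambda>x::real. x ^ (2 * i) / 2 powr (x / 2 - 1)) \<longlongrightarrow> 0) at_top" for i :: nat
    by real_asymp
  then have "((\<lambda>n. real n ^ (2 * i) / 2 powr (real n / 2 - 1)) \<longlongrightarrow> 0) sequentially" for i :: nat
    by (rule filterlim_compose) (rule filterlim_real_sequentially)
  then have "((\<lambda>n. \<Sum>i\<le>degree P. coeff P i * (real n ^ (2 * i) / 2 powr (real n / 2 - 1)))
      \<longlongrightarrow> (\<Sum>i\<le>degree P. coeff P i * 0)) sequentially"
    by (intro tendsto_intros)
  then have "((\<lambda>n. poly P (real (n ^ 2)) / 2 powr (real n / 2 - 1)) \<longlongrightarrow> 0) sequentially"
    by (simp add: poly_altdef sum_divide_distrib power_mult)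
  then have "\<forall>\<^sub>F n in sequentially. poly P (real (n ^ 2)) / 2 powr (real n / 2 - 1) < 1"
    by (rule order_tendstoD) simp
  then show ?thesis
  proof eventually_elim
    case (elim n)
    have "real n / 2 - 1 \<le> real (n div 2)"
      by linarith
    then have "2 powr (real n / 2 - 1) \<le> 2 powr real (n div 2)"
      by (intro powr_mono) auto
    with elim show ?case
      by (simp add: powr_realpow)
  qed
qed

theorem proposition5p17:
  fixes u v f :: "nat \<Rightarrow> letter list" and w :: "int \<Rightarrow> letter"
  assumes "construction u v f"
    and "limit_word u v f w"
  shows "\<not> (\<exists>P :: real poly. \<forall>\<^sub>F n in sequentially. real (complexity w n) \<le> poly P (real n))"
proof
  assume "\<exists>P :: real poly. \<forall>\<^sub>F n in sequentially. real (complexity w n) \<le> poly P (real n)"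
  then obtain P :: "real poly" and N where
    N: "\<And>n. n \<ge> N \<Longrightarrow> real (complexity w n) \<le> poly P (real n)"
    by (auto simp: eventually_sequentially)
  obtain M where M: "\<And>n. n \<ge> M \<Longrightarrow> poly P (real (n ^ 2)) < 2 ^ (n div 2)"
    using eventually_poly_square_less_exp[of P] by (auto simp: eventually_sequentially)
  \<comment> \<open>\<open>L\<close> is at least \<open>k\<close>, so this choice puts
    \<open>L\<close> beyond both thresholds; \<open>Suc\<close> ensures \<open>k \<ge> 1\<close>,
    where the construction begins.\<close>
  define k where "k = Suc (max M N)"
  define L where "L = length (u k)"
  have "k \<le> L"
    using construction_lengths[OF assms(1), of k] by (simp add: k_def L_def)
  then have "M \<le> L" "N \<le> L"
    by (simp_all add: k_def)
  \<comment> \<open>The bound from \<open>N\<close> is applied at \<open>L ^ 2\<close>, the one from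
    \<open>M\<close> at \<open>L\<close>.\<close>
  moreover have "L \<le> L ^ 2"
    by (rule self_le_power) (use \<open>k \<le> L\<close> in \<open>simp_all add: k_def\<close>)
  ultimately have "real (complexity w (L ^ 2)) < 2 ^ (L div 2)"
    using N[of "L ^ 2"] M[of L] by linarith
  moreover have "2 ^ (L div 2) \<le> complexity w (L ^ 2)"
    unfolding L_def by (rule complexity_lower_bound[OF assms]) (simp add: k_def)
  then have "2 ^ (L div 2) \<le> real (complexity w (L ^ 2))"
    by (metis of_nat_le_iff of_nat_numeral of_nat_power)
  ultimately show False
    by simp
qed

end
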